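(* Let $\nu\in(0,1)$ and $\alpha_1(\nu):=1-\nu$. Let $\{S(t):t\geq 0\}$ be a real-valued Lévy process such that $\log\mathbb{E}[e^{\theta S(1)}]$ is finite in a neighborhood of $\theta=0$; assume that $\{S(t):t\geq 0\}$ has bounded variation and is not a subordinator. Let $\{S_1(t):t\geq 0\}$ and $\{S_2(t):t\geq 0\}$ be two non-null independent subordinators such that $\{S(t):t\geq 0\}$ is distributed as $\{S_1(t)-S_2(t):t\geq 0\}$, and let $\kappa_{S_i}(\theta):=\log\mathbb{E}[e^{\theta S_i(1)}]$ and $m_i:=\kappa_{S_i}'(0)$ for $i=1,2$. Let $\{L_{\nu}^{(1)}(t):t\geq 0\}$ and $\{L_{\nu}^{(2)}(t):t\geq 0\}$ be two independent inverses of stable subordinators, both of index $\nu$, independent of $\{(S_1(t),S_2(t)):t\geq 0\}$. Then $$\left\{t^{\alpha_1(\nu)}\frac{S_1(L_\nu^{(1)}(t))-S_2(L_\nu^{(2)}(t))}{t}:t>0\right\}$$ converges weakly, as $t\to\infty$, to $m_1L_\nu^{(1)}(1)-m_2L_\nu^{(2)}(1)$.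
   Context: A subordinator is a nondecreasing real-valued Lévy process; non-null means not identically zero. Under the stated assumptions on $S$ the functions $\kappa_{S_1},\kappa_{S_2}$ are finite in a neighborhood of the origin, and $m_1,m_2>0$. Inverse of a stable subordinator: for $\nu\in(0,1)$, $L_\nu(t)=\inf\{u\geq 0: H_\nu(u)>t\}$, where $\{H_\nu(u):u\ge 0\}$ is the stable subordinator with $\mathbb{E}[e^{-\xi H_\nu(u)}]=e^{-u\xi^\nu}$ for $\xi\geq 0$. Its moment generating function is $\mathbb{E}[e^{\theta L_\nu(t)}]=E_\nu(\theta t^\nu)$ for all $\theta\in\mathbb{R}$, where $E_\nu(x):=\sum_{k=0}^\infty\frac{x^k}{\Gamma(\nu k+1)}$ is the Mittag-Leffler function. Weak convergence means convergence in distribution. *)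

theory Defs
  imports "HOL-Probability.Probability"
begin

text \<open>
  Processes have type \<open>real \<Rightarrow> 'a \<Rightarrow> real\<close> and are indexed by the times \<open>t \<ge> 0\<close>;
  their values at negative times are irrelevant.
\<close>

definition cadlag :: "(real \<Rightarrow> real) \<Rightarrow> bool" where
  "cadlag f \<longleftrightarrow> (\<forall>t\<ge>0. continuous (at_right t) f) \<and> (\<forall>t>0. \<exists>l. (f \<longlongrightarrow> l) (at_left t))"

definition bounded_variation_on :: "real \<Rightarrow> real \<Rightarrow> (real \<Rightarrow> real) \<Rightarrow> bool" where
  "bounded_variation_on a b f \<longleftrightarrow>
     (\<exists>B. \<forall>n. \<forall>s :: nat \<Rightarrow> real. mono_on {..n} s \<and> s ` {..n} \<subseteq> {a..b} \<longrightarrow>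
        (\<Sum>i<n. \<bar>f (s (Suc i)) - f (s i)\<bar>) \<le> B)"

locale levy_process = prob_space M
  for M :: "'a measure" and X :: "real \<Rightarrow> 'a \<Rightarrow> real" +
  assumes measurable_X: "\<And>t. 0 \<le> t \<Longrightarrow> X t \<in> borel_measurable M"
    and X_zero: "AE \<omega> in M. X 0 \<omega> = 0"
    and independent_increments:
      "\<And>n (t :: nat \<Rightarrow> real). 0 \<le> t 0 \<Longrightarrow> mono_on {..n} t \<Longrightarrow>
         indep_vars (\<lambda>_. borel) (\<lambda>i \<omega>. X (t (Suc i)) \<omega> - X (t i) \<omega>) {..<n}"
    and stationary_increments:
      "\<And>t h. 0 \<le> t \<Longrightarrow> 0 \<le> h \<Longrightarrow>
         distr M borel (\<lambda>\<omega>. X (t + h) \<omega> - X t \<omega>) = distr M borel (X h)"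
    and cadlag_paths: "AE \<omega> in M. cadlag (\<lambda>t. X t \<omega>)"

locale subordinator = levy_process +
  assumes nondecreasing_paths: "AE \<omega> in M. mono_on {0..} (\<lambda>t. X t \<omega>)"

locale stable_subordinator = subordinator M H
  for M :: "'a measure" and H :: "real \<Rightarrow> 'a \<Rightarrow> real" and \<nu> :: real +
  assumes laplace_transform:
    "\<And>u \<xi>. 0 \<le> u \<Longrightarrow> 0 \<le> \<xi> \<Longrightarrow> expectation (\<lambda>\<omega>. exp (- \<xi> * H u \<omega>)) = exp (- u * \<xi> powr \<nu>)"

definition has_bounded_variation :: "'a measure \<Rightarrow> (real \<Rightarrow> 'a \<Rightarrow> real) \<Rightarrow> bool" where
  "has_bounded_variation M X \<longleftrightarrow> (AE \<omega> in M. \<forall>T\<ge>0. bounded_variation_on 0 T (\<lambda>t. X t \<omega>))"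

definition null_process :: "'a measure \<Rightarrow> (real \<Rightarrow> 'a \<Rightarrow> real) \<Rightarrow> bool" where
  "null_process M X \<longleftrightarrow> (AE \<omega> in M. \<forall>t\<ge>0. X t \<omega> = 0)"

text \<open>
  The infimum is over the reals, so it is unspecified for those \<open>\<omega>\<close> whose path never exceeds
  \<open>t\<close>; for a stable subordinator these form a null set.
\<close>

definition inverse_process :: "(real \<Rightarrow> 'a \<Rightarrow> real) \<Rightarrow> real \<Rightarrow> 'a \<Rightarrow> real" where
  "inverse_process H t \<omega> = Inf {u. 0 \<le> u \<and> H u \<omega> > t}"

text \<open>
  A process seen as one random element of the product space of real functions on \<open>[0, \<infinity>)\<close>.
  Laws and independence of processes refer to this space.
\<close>

abbreviation path_space :: "(real \<Rightarrow> real) measure" where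
  "path_space \<equiv> Pi\<^sub>M {0..} (\<lambda>_. borel)"

definition sample_path :: "(real \<Rightarrow> 'a \<Rightarrow> real) \<Rightarrow> 'a \<Rightarrow> real \<Rightarrow> real" where
  "sample_path X \<omega> = (\<lambda>t\<in>{0..}. X t \<omega>)"

text \<open>
  Finiteness of the logarithm is integrability of the exponential; where the latter fails,
  the value of \<open>log_mgf\<close> is meaningless.
\<close>

definition log_mgf :: "'a measure \<Rightarrow> ('a \<Rightarrow> real) \<Rightarrow> real \<Rightarrow> real" where
  "log_mgf M Y \<theta> = ln (\<integral>\<omega>. exp (\<theta> * Y \<omega>) \<partial>M)"

definition log_mgf_finite_near_0 :: "'a measure \<Rightarrow> ('a \<Rightarrow> real) \<Rightarrow> bool" where
  "log_mgf_finite_near_0 M Y \<longleftrightarrow> (\<forall>\<^sub>F \<theta> in nhds 0. integrable M (\<lambda>\<omega>. exp (\<theta> * Y \<omega>)))"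

text \<open>
  The library's \<open>weak_conv_m\<close>, with an arbitrary filter in place of \<open>sequentially\<close>.
\<close>

definition weak_conv_filter :: "('i \<Rightarrow> real measure) \<Rightarrow> real measure \<Rightarrow> 'i filter \<Rightarrow> bool" where
  "weak_conv_filter \<mu> \<mu>' F \<longleftrightarrow> (\<forall>x. isCont (cdf \<mu>') x \<longrightarrow> ((\<lambda>t. cdf (\<mu> t) x) \<longlongrightarrow> cdf \<mu>' x) F)"

text \<open>
  Path properties are only required almost surely, so a random variable obtained by evaluating a
  process at a random time need only be measurable up to a null set. Its law is therefore
  taken under the completion; for variables measurable with respect to \<open>M\<close> this is \<open>distr M borel\<close>.
\<close>

definition law :: "'a measure \<Rightarrow> ('a \<Rightarrow> real) \<Rightarrow> real measure" where
  "law M Y = distr (completion M) borel Y"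

end

theory Submission
  imports Defs "HOL-Real_Asymp.Real_Asymp"
begin

text \<open>
  Since \<open>t powr \<alpha>1 / t = 1 / t powr \<nu>\<close>, the claim concerns
  \<open>X t = (S1 (L1 t) - S2 (L2 t)) / t powr \<nu>\<close>. Replace each subordinator by its mean drift, which
  gives \<open>Y t = (m1 * L1 t - m2 * L2 t) / t powr \<nu>\<close>. Two facts finish the proof: the law of \<open>Y t\<close>
  is the limit law for every \<open>t > 0\<close>, and \<open>X t - Y t\<close> tends to \<open>0\<close> in probability.

  The first fact is the self-similarity of the inverse of a stable subordinator. The Laplace
  transform shows that \<open>H (u * t powr \<nu>)\<close> and \<open>t * H u\<close> have the same law
  (\<open>distr_self_similar\<close>). The level \<open>t\<close> is passed before the time \<open>u\<close> precisely when
  \<open>H u > t\<close>, up to the distinction between \<open><\<close> and \<open>\<le>\<close>, so the distribution function of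
  \<open>L t / t powr \<nu>\<close> is that of \<open>L 1\<close> (\<open>distr_inverse_process_self_similar\<close>). Independence of
  \<open>L1\<close> and \<open>L2\<close> carries this over to the pair.

  The second fact is a weak law of large numbers for \<open>S1\<close> and \<open>S2\<close>, uniform on \<open>[0, K * s]\<close> at
  scale \<open>s = t powr \<nu>\<close> (\<open>uniform_weak_law\<close>). Chebyshev's inequality gives it at a number of grid
  points that does not grow with \<open>s\<close>, and monotonicity of the paths interpolates between them.
  The law of \<open>L t / t powr \<nu>\<close> does not depend on \<open>t\<close>, hence \<open>L t \<le> K * t powr \<nu>\<close> with
  probability close to \<open>1\<close>, and on this event the uniform law applies at the random time \<open>L t\<close>
  (\<open>weak_law_at_random_times\<close>).

  Second moments of \<open>S1 1\<close> and \<open>S2 1\<close>, and the identification of \<open>m1\<close> and \<open>m2\<close> with their means,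
  come from exponential moments. These are assumed for \<open>S\<close> only; as \<open>S 1\<close> has the law of
  \<open>S1 1 - S2 1\<close> with independent terms, its moment generating function factorises and both factors
  are finite near the origin (\<open>exp_moments_of_difference\<close>).
\<close>

section \<open>Laplace transforms determine laws on the half-line\<close>

lemma char_moment_bound:
  assumes "real_distribution \<mu>" and "AE x in \<mu>. \<bar>x\<bar> \<le> 1"
  shows "cmod (char \<mu> t - (\<Sum>k\<le>n. ((\<i> * t) ^ k / fact k) * (\<integral>x. x ^ k \<partial>\<mu>))) \<le> 2 * \<bar>t\<bar> ^ n / fact n"
proof -
  interpret real_distribution \<mu> by fact
  have le: "AE x in \<mu>. \<bar>x\<bar> ^ k \<le> 1" for k :: nat
    using assms(2) by eventually_elim (auto intro: power_le_one)
  have int: "integrable \<mu> (\<lambda>x. x ^ k)" for k :: nat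
    using le[of k] by (intro integrable_const_bound[where B = 1]) (auto simp: power_abs)
  have "expectation (\<lambda>x. \<bar>x\<bar> ^ n) \<le> 1"
    using le[of n] int[of n] by (intro integral_le_const) (auto simp: power_abs[symmetric])
  then have "2 * \<bar>t\<bar> ^ n / fact n * expectation (\<lambda>x. \<bar>x\<bar> ^ n) \<le> 2 * \<bar>t\<bar> ^ n / fact n"
    by (intro mult_left_le) auto
  with char_approx1[of n t, OF int] show ?thesis by linarith
qed

text \<open>
  Moments determine a law on \<open>[-1, 1]\<close>, because the power series of its characteristic function
  converges everywhere and has the moments as coefficients.
\<close>

lemma real_distribution_eq_of_moments:
  assumes "real_distribution \<mu>" and "real_distribution \<mu>'"
    and "AE x in \<mu>. \<bar>x\<bar> \<le> 1" and "AE x in \<mu>'. \<bar>x\<bar> \<le> 1"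
    and moments: "\<And>n :: nat. (\<integral>x. x ^ n \<partial>\<mu>) = (\<integral>x. x ^ n \<partial>\<mu>')"
  shows "\<mu> = \<mu>'"
proof (rule Levy_uniqueness[OF assms(1,2)], rule ext)
  fix t
  have "cmod (char \<mu> t - char \<mu>' t) \<le> 4 * (\<bar>t\<bar> ^ n /\<^sub>R fact n)" for n
    using norm_triangle_le_diff[OF add_mono[OF char_moment_bound[OF assms(1,3), of t n] char_moment_bound[OF assms(2,4), of t n]]]
    unfolding moments by (simp add: divide_inverse mult_ac)
  moreover have "(\<lambda>n. 4 * (\<bar>t\<bar> ^ n /\<^sub>R fact n)) \<longlonglongrightarrow> 4 * 0"
    by (intro tendsto_mult tendsto_const summable_LIMSEQ_zero summable_exp_generic)
  ultimately have "cmod (char \<mu> t - char \<mu>' t) \<le> 4 * 0"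
    by (intro LIMSEQ_le_const[where X = "\<lambda>n. 4 * (\<bar>t\<bar> ^ n /\<^sub>R fact n)"]) blast+
  then show "char \<mu> t = char \<mu>' t" by simp
qed

text \<open>
  For \<open>X \<ge> 0\<close> the variable \<open>exp (- X)\<close> lies in \<open>(0, 1]\<close>, and its moments are the values of the
  Laplace transform of \<open>X\<close> at the natural numbers.
\<close>

lemma (in prob_space) distr_eq_of_laplace_transform:
  fixes X Y :: "'a \<Rightarrow> real"
  assumes [measurable]: "random_variable borel X" "random_variable borel Y"
    and "AE \<omega> in M. 0 \<le> X \<omega>" and "AE \<omega> in M. 0 \<le> Y \<omega>"
    and eq: "\<And>n :: nat. expectation (\<lambda>\<omega>. exp (- real n * X \<omega>)) = expectation (\<lambda>\<omega>. exp (- real n * Y \<omega>))"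
  shows "distr M borel X = distr M borel Y"
proof -
  have moment: "(\<integral>x. x ^ n \<partial>distr M borel (\<lambda>\<omega>. exp (- Z \<omega>))) = expectation (\<lambda>\<omega>. exp (- real n * Z \<omega>))"
    if [measurable]: "random_variable borel Z" for Z and n :: nat
    by (subst integral_distr) (auto simp: exp_of_nat_mult[symmetric] mult_ac)
  have "distr M borel (\<lambda>\<omega>. exp (- X \<omega>)) = distr M borel (\<lambda>\<omega>. exp (- Y \<omega>))"
    using assms by (intro real_distribution_eq_of_moments) (auto simp: AE_distr_iff moment)
  then have "distr (distr M borel (\<lambda>\<omega>. exp (- X \<omega>))) borel (\<lambda>y. - ln y)
      = distr (distr M borel (\<lambda>\<omega>. exp (- Y \<omega>))) borel (\<lambda>y. - ln y)"
    by simp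
  then show ?thesis by (simp add: distr_distr comp_def)
qed

section \<open>Self-similarity of inverse stable subordinators\<close>

lemma (in subordinator) nonneg_AE:
  assumes "0 \<le> t"
  shows "AE \<omega> in M. 0 \<le> X t \<omega>"
  using X_zero nondecreasing_paths
proof eventually_elim
  case (elim \<omega>)
  from elim(2) have "X 0 \<omega> \<le> X t \<omega>" using assms by (auto simp: mono_on_def)
  with elim(1) show ?case by simp
qed

lemma (in stable_subordinator) distr_self_similar:
  assumes "0 \<le> u" and "0 < c"
  shows "distr M borel (H (u * c powr \<nu>)) = distr M borel (\<lambda>\<omega>. c * H u \<omega>)"
proof (rule distr_eq_of_laplace_transform)
  show "random_variable borel (H (u * c powr \<nu>))" "random_variable borel (\<lambda>\<omega>. c * H u \<omega>)"
    using assms by (auto intro!: measurable_X borel_measurable_times)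
  show "AE \<omega> in M. 0 \<le> H (u * c powr \<nu>) \<omega>"
    using assms by (intro nonneg_AE) auto
  show "AE \<omega> in M. 0 \<le> c * H u \<omega>"
    using nonneg_AE[OF assms(1)] by eventually_elim (use assms in simp)
  fix n :: nat
  have "expectation (\<lambda>\<omega>. exp (- real n * (c * H u \<omega>))) = expectation (\<lambda>\<omega>. exp (- (real n * c) * H u \<omega>))"
    by (simp add: mult_ac)
  also have "\<dots> = exp (- u * (real n * c) powr \<nu>)"
    using assms by (intro laplace_transform) auto
  also have "\<dots> = exp (- (u * c powr \<nu>) * real n powr \<nu>)"
    using assms by (simp add: powr_mult mult_ac)
  also have "\<dots> = expectation (\<lambda>\<omega>. exp (- real n * H (u * c powr \<nu>) \<omega>))"
    using assms by (intro laplace_transform[symmetric]) auto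
  finally show "expectation (\<lambda>\<omega>. exp (- real n * H (u * c powr \<nu>) \<omega>)) =
      expectation (\<lambda>\<omega>. exp (- real n * (c * H u \<omega>)))" ..
qed

text \<open>
  By Markov's inequality for \<open>exp (- H n)\<close>, whose expectation is \<open>exp (- n)\<close>, the probability of
  \<open>H n \<le> t\<close> is at most \<open>exp (t - n)\<close>. The infimum that defines \<open>inverse_process H t\<close> is therefore
  almost surely over a nonempty set.
\<close>

lemma (in stable_subordinator) exceeds_AE:
  "AE \<omega> in M. \<exists>u\<ge>0. t < H u \<omega>"
proof -
  have [measurable]: "H (real n) \<in> borel_measurable M" for n
    by (intro measurable_X) auto
  define B where "B = {\<omega> \<in> space M. \<forall>n. H (real n) \<omega> \<le> t}"
  have [measurable]: "B \<in> sets M" unfolding B_def by measurable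
  have "prob B \<le> exp t * exp (- real n)" for n
  proof -
    have int: "integrable M (\<lambda>\<omega>. exp (- 1 * H (real n) \<omega>))"
      using nonneg_AE[of "real n"] by (intro integrable_const_bound[where B = 1]) auto
    have "prob B = expectation (\<lambda>\<omega>. indicator B \<omega>)" by simp
    also have "\<dots> \<le> expectation (\<lambda>\<omega>. exp t * exp (- 1 * H (real n) \<omega>))"
    proof (rule integral_mono)
      show "integrable M (indicator B :: 'a \<Rightarrow> real)"
        by (intro integrable_real_indicator) (auto simp: emeasure_eq_measure)
      show "integrable M (\<lambda>\<omega>. exp t * exp (- 1 * H (real n) \<omega>))"
        by (intro integrable_mult_right int)
      show "indicator B \<omega> \<le> exp t * exp (- 1 * H (real n) \<omega>)" for \<omega>
        by (auto simp: indicator_def B_def simp flip: exp_add)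
    qed
    also have "\<dots> = exp t * exp (- real n)"
      using laplace_transform[of "real n" 1] by simp
    finally show ?thesis .
  qed
  moreover have "(\<lambda>n. exp t * exp (- real n)) \<longlonglongrightarrow> exp t * 0"
    by (intro tendsto_mult tendsto_const) real_asymp
  ultimately have "prob B \<le> exp t * 0"
    by (intro LIMSEQ_le_const[where X = "\<lambda>n. exp t * exp (- real n)"]) blast+
  then have "prob B = 0" using measure_nonneg[of M B] by simp
  then have "AE \<omega> in M. \<omega> \<notin> B"
    by (intro AE_not_in) (auto simp: null_sets_def emeasure_eq_measure)
  then show ?thesis
    using AE_space
    by eventually_elim (auto simp: B_def not_le intro: exI[of _ "real _"])
qed

text \<open>
  The two implications sandwich the event \<open>t < H u\<close> between \<open>inverse_process H t < u\<close> and
  \<open>inverse_process H t \<le> u\<close>. The gap is harmless for distribution functions, by the lemma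
  \<open>cdf_le_of_interlaced\<close> below.
\<close>

lemma (in stable_subordinator) inverse_process_iff_AE:
  "AE \<omega> in M. 0 \<le> inverse_process H t \<omega> \<and>
     (\<forall>u\<ge>0. (inverse_process H t \<omega> < u \<longrightarrow> t < H u \<omega>) \<and> (t < H u \<omega> \<longrightarrow> inverse_process H t \<omega> \<le> u))"
  using exceeds_AE[of t] nondecreasing_paths
proof eventually_elim
  case (elim \<omega>)
  let ?A = "{u. 0 \<le> u \<and> t < H u \<omega>}"
  have ne: "?A \<noteq> {}" and bdd: "bdd_below ?A" using elim(1) by (auto intro: bdd_belowI[of _ 0])
  have "t < H u \<omega>" if "Inf ?A < u" "0 \<le> u" for u
  proof -
    from that obtain v where v: "v \<in> ?A" "v < u"
      using cInf_less_iff[OF ne bdd] by auto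
    with elim(2) that have "H v \<omega> \<le> H u \<omega>" by (auto simp: mono_on_def)
    with v show ?thesis by auto
  qed
  moreover have "0 \<le> Inf ?A" using ne by (intro cInf_greatest) auto
  ultimately show ?case
    unfolding inverse_process_def by (auto intro!: cInf_lower[OF _ bdd])
qed

lemma (in prob_space) cdf_distr_eq_prob:
  "Z \<in> borel_measurable M \<Longrightarrow> cdf (distr M borel Z) x = prob {\<omega> \<in> space M. Z \<omega> \<le> x}"
  unfolding cdf_def by (subst measure_distr) (auto intro!: arg_cong[where f = prob])

lemma cdf_le_of_interlaced:
  assumes "real_distribution \<mu>" 
    and le: "\<And>v w. v < w \<Longrightarrow> cdf \<mu>' v \<le> cdf \<mu> w"
  shows "cdf \<mu>' v \<le> cdf \<mu> v"
proof -
  interpret real_distribution \<mu> by fact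
  have "(cdf \<mu> \<longlongrightarrow> cdf \<mu> v) (at_right v)"
    using cdf_is_right_cont[of v] by (simp add: continuous_within)
  moreover have "\<forall>\<^sub>F w in at_right v. cdf \<mu>' v \<le> cdf \<mu> w"
    using eventually_at_right_less[of v] by eventually_elim (rule le)
  ultimately show ?thesis
    by (intro tendsto_lowerbound) auto
qed

text \<open>
  For \<open>v < w\<close> the probability of \<open>L t / t powr \<nu> \<le> v\<close> is at most that of \<open>H (w * t powr \<nu>) > t\<close>.
  By self-similarity of \<open>H\<close> the latter does not depend on \<open>t\<close>, and at \<open>s\<close> in place of \<open>t\<close> it is at
  most the probability of \<open>L s / s powr \<nu> \<le> w\<close>. The roles of \<open>s\<close> and \<open>t\<close> can be exchanged, so the
  two distribution functions interlace and therefore agree.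
\<close>

lemma (in stable_subordinator) distr_inverse_process_self_similar:
  assumes meas: "\<And>t. 0 \<le> t \<Longrightarrow> inverse_process H t \<in> borel_measurable M" and "0 < t"
  shows "distr M borel (\<lambda>\<omega>. inverse_process H t \<omega> / t powr \<nu>) = distr M borel (inverse_process H 1)"
proof -
  let ?Z = "\<lambda>t \<omega>. inverse_process H t \<omega> / t powr \<nu>"
  have Z[measurable]: "?Z t \<in> borel_measurable M" if "0 < t" for t
    using that by (intro borel_measurable_divide meas) auto
  have [measurable]: "H u \<in> borel_measurable M" if "0 \<le> u" for u
    using that by (intro measurable_X) auto
  have H: "prob {\<omega> \<in> space M. t < H (v * t powr \<nu>) \<omega>} = prob {\<omega> \<in> space M. 1 < H v \<omega>}"
    if "0 < t" "0 \<le> v" for t v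
  proof -
    have [measurable]: "H v \<in> borel_measurable M" "H (v * t powr \<nu>) \<in> borel_measurable M"
      using that by auto
    have "prob {\<omega> \<in> space M. t < H (v * t powr \<nu>) \<omega>} = measure (distr M borel (H (v * t powr \<nu>))) {t<..}"
      by (subst measure_distr) (auto intro!: arg_cong[where f = prob])
    also have "\<dots> = measure (distr M borel (\<lambda>\<omega>. t * H v \<omega>)) {t<..}"
      using that by (simp add: distr_self_similar)
    also have "\<dots> = prob {\<omega> \<in> space M. 1 < H v \<omega>}"
      using that by (subst measure_distr) (auto intro!: arg_cong[where f = prob])
    finally show ?thesis .
  qed
  have "cdf (distr M borel (?Z t)) v \<le> cdf (distr M borel (?Z s)) w"
    if "0 < t" "0 < s" "v < w" for s t v w
  proof (cases "0 \<le> w")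
    case True
    have [measurable]: "H (w * t powr \<nu>) \<in> borel_measurable M" "H (w * s powr \<nu>) \<in> borel_measurable M"
      "?Z t \<in> borel_measurable M" "?Z s \<in> borel_measurable M"
      using that True by auto
    have "cdf (distr M borel (?Z t)) v = prob {\<omega> \<in> space M. ?Z t \<omega> \<le> v}"
      by (rule cdf_distr_eq_prob) measurable
    also have "\<dots> \<le> prob {\<omega> \<in> space M. t < H (w * t powr \<nu>) \<omega>}"
    proof (rule finite_measure_mono_AE)
      show "AE \<omega> in M. \<omega> \<in> {\<omega> \<in> space M. ?Z t \<omega> \<le> v} \<longrightarrow> \<omega> \<in> {\<omega> \<in> space M. t < H (w * t powr \<nu>) \<omega>}"
        using inverse_process_iff_AE[of t]
      proof eventually_elim
        case (elim \<omega>)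
        have "v * t powr \<nu> < w * t powr \<nu>" using that by simp
        moreover have "0 \<le> w * t powr \<nu>" using True by simp
        moreover have "?Z t \<omega> \<le> v \<longleftrightarrow> inverse_process H t \<omega> \<le> v * t powr \<nu>"
          using that by (simp add: field_simps)
        ultimately show ?case using elim by auto
      qed
    qed measurable
    also have "\<dots> = prob {\<omega> \<in> space M. s < H (w * s powr \<nu>) \<omega>}"
      using that True by (simp add: H)
    also have "\<dots> \<le> prob {\<omega> \<in> space M. ?Z s \<omega> \<le> w}"
    proof (rule finite_measure_mono_AE)
      show "AE \<omega> in M. \<omega> \<in> {\<omega> \<in> space M. s < H (w * s powr \<nu>) \<omega>} \<longrightarrow> \<omega> \<in> {\<omega> \<in> space M. ?Z s \<omega> \<le> w}"
        using inverse_process_iff_AE[of s]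
        by eventually_elim (use that True in \<open>auto simp: field_simps\<close>)
    qed measurable
    also have "\<dots> = cdf (distr M borel (?Z s)) w"
      by (rule cdf_distr_eq_prob[symmetric]) measurable
    finally show ?thesis .
  next
    case False
    have [measurable]: "?Z t \<in> borel_measurable M" using that by simp
    have "AE \<omega> in M. \<not> ?Z t \<omega> \<le> v"
      using inverse_process_iff_AE[of t]
    proof eventually_elim
      case (elim \<omega>)
      then have "0 \<le> ?Z t \<omega>" by simp
      then show ?case using False that by linarith
    qed
    then have "prob {\<omega> \<in> space M. ?Z t \<omega> \<le> v} = 0" by (simp add: prob_eq_0)
    then have "cdf (distr M borel (?Z t)) v = 0"
      by (subst cdf_distr_eq_prob) auto
    then show ?thesis by (simp add: cdf_def)
  qed
  note le = this
  have dist: "real_distribution (distr M borel (?Z s))" if "0 < s" for s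
    using that by (intro real_distribution_distr) auto
  have "distr M borel (?Z t) = distr M borel (?Z 1)"
  proof (rule cdf_unique)
    show "cdf (distr M borel (?Z t)) = cdf (distr M borel (?Z 1))"
      using \<open>0 < t\<close> by (intro ext antisym cdf_le_of_interlaced dist le) auto
  qed (intro dist \<open>0 < t\<close> zero_less_one)+
  then show ?thesis by simp
qed

section \<open>Exponential moments\<close>

lemma abs_exp_minus_one_minus_le: "\<bar>exp y - 1 - y\<bar> \<le> y\<^sup>2 * exp \<bar>y\<bar>" for y :: real
proof -
  have lower: "0 \<le> exp y - 1 - y" using exp_ge_add_one_self[of y] by linarith
  have "(1 - y) * exp y \<le> exp (- y) * exp y"
    using exp_ge_add_one_self[of "- y"] by (intro mult_right_mono) auto
  then have exp_le: "exp y - 1 - y \<le> y * (exp y - 1)"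
    by (simp add: algebra_simps flip: exp_add)
  have "y * (exp y - 1) \<le> y\<^sup>2 * exp \<bar>y\<bar>"
  proof (cases "0 \<le> y")
    case True
    have "exp y - 1 \<le> y * exp y"
      using exp_le by (simp add: algebra_simps)
    then have "y * (exp y - 1) \<le> y * (y * exp y)" using True by (rule mult_left_mono)
    then show ?thesis using True by (simp add: power2_eq_square mult_ac)
  next
    case False
    have "y * (exp y - 1) \<le> y * y"
      using False exp_ge_add_one_self[of y] by (intro mult_left_mono_neg) linarith+
    also have "\<dots> \<le> y\<^sup>2 * exp \<bar>y\<bar>" by (simp add: power2_eq_square mult_le_cancel_left1)
    finally show ?thesis .
  qed
  with lower exp_le show ?thesis by simp
qed

lemma square_le_exp: "x\<^sup>2 \<le> 8 / c\<^sup>2 * exp (c * \<bar>x\<bar> / 2)" if "0 < c" for x c :: real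
proof -
  have "(c * \<bar>x\<bar> / 2)\<^sup>2 / 2 \<le> exp (c * \<bar>x\<bar> / 2)"
  proof -
    have "0 \<le> c * \<bar>x\<bar> / 2" using that by simp
    with exp_lower_Taylor_quadratic[OF this] show ?thesis by linarith
  qed
  with that show ?thesis by (simp add: field_simps power2_eq_square)
qed

lemma (in prob_space) square_integrable_of_exp:
  fixes X :: "'a \<Rightarrow> real" and c :: real
  assumes [measurable]: "random_variable borel X"
    and c: "0 < c" and int: "integrable M (\<lambda>\<omega>. exp (c * \<bar>X \<omega>\<bar>))"
  shows "integrable M (\<lambda>\<omega>. (X \<omega>)\<^sup>2)"
proof (rule Bochner_Integration.integrable_bound)
  show "integrable M (\<lambda>\<omega>. 8 / c\<^sup>2 * exp (c * \<bar>X \<omega>\<bar>))"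
    using int by (rule integrable_mult_right)
  have "(X \<omega>)\<^sup>2 \<le> 8 / c\<^sup>2 * exp (c * \<bar>X \<omega>\<bar>)" for \<omega>
    by (rule order_trans[OF square_le_exp[OF c] mult_left_mono]) (use c in auto)
  then show "AE \<omega> in M. norm ((X \<omega>)\<^sup>2) \<le> norm (8 / c\<^sup>2 * exp (c * \<bar>X \<omega>\<bar>))"
    by (simp add: abs_mult)
qed measurable

text \<open>
  The second-order remainder of \<open>exp (h * X)\<close> is at most \<open>h\<^sup>2\<close> times a fixed integrable variable
  for \<open>\<bar>h\<bar> \<le> c / 2\<close>; the other half of the exponent \<open>c\<close> absorbs the factor \<open>X\<^sup>2\<close>.
\<close>

lemma (in prob_space) log_mgf_has_derivative_at_0:
  fixes X :: "'a \<Rightarrow> real" and c :: real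
  assumes [measurable]: "random_variable borel X"
    and c: "0 < c" and int: "integrable M (\<lambda>\<omega>. exp (c * \<bar>X \<omega>\<bar>))"
  shows "(log_mgf M X has_real_derivative expectation X) (at 0)"
proof -
  define C where "C = 8 / c\<^sup>2 * expectation (\<lambda>\<omega>. exp (c * \<bar>X \<omega>\<bar>))"
  have intX: "integrable M X"
    using square_integrable_of_exp[OF assms] by (rule square_integrable_imp_integrable[rotated]) simp
  have bound: "\<bar>expectation (\<lambda>\<omega>. exp (h * X \<omega>)) - 1 - h * expectation X\<bar> \<le> h\<^sup>2 * C"
    if h: "\<bar>h\<bar> \<le> c / 2" for h
  proof -
    have inth: "integrable M (\<lambda>\<omega>. exp (h * X \<omega>))"
    proof (rule Bochner_Integration.integrable_bound[OF int])
      have "h * X \<omega> \<le> c * \<bar>X \<omega>\<bar>" for \<omega>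
      proof -
        have "h * X \<omega> \<le> \<bar>h\<bar> * \<bar>X \<omega>\<bar>" by (simp flip: abs_mult)
        also have "\<dots> \<le> c * \<bar>X \<omega>\<bar>" using h c by (intro mult_right_mono) auto
        finally show ?thesis .
      qed
      then show "AE \<omega> in M. norm (exp (h * X \<omega>)) \<le> norm (exp (c * \<bar>X \<omega>\<bar>))" by simp
    qed measurable
    have "\<bar>exp (h * X \<omega>) - 1 - h * X \<omega>\<bar> \<le> h\<^sup>2 * (8 / c\<^sup>2 * exp (c * \<bar>X \<omega>\<bar>))" for \<omega>
    proof -
      have "\<bar>exp (h * X \<omega>) - 1 - h * X \<omega>\<bar> \<le> (h * X \<omega>)\<^sup>2 * exp \<bar>h * X \<omega>\<bar>"
        by (rule abs_exp_minus_one_minus_le)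
      also have "\<dots> \<le> (h\<^sup>2 * (8 / c\<^sup>2 * exp (c * \<bar>X \<omega>\<bar> / 2))) * exp (c * \<bar>X \<omega>\<bar> / 2)"
        using mult_right_mono[OF h, of "\<bar>X \<omega>\<bar>"]
        by (intro mult_mono) (auto simp: power_mult_distrib abs_mult simp del: times_divide_eq_left times_divide_eq_right
              intro!: mult_left_mono square_le_exp c)
      also have "\<dots> = h\<^sup>2 * (8 / c\<^sup>2 * exp (c * \<bar>X \<omega>\<bar>))"
        by (simp flip: exp_add)
      finally show ?thesis .
    qed
    then have "\<bar>expectation (\<lambda>\<omega>. exp (h * X \<omega>) - 1 - h * X \<omega>)\<bar>
        \<le> expectation (\<lambda>\<omega>. h\<^sup>2 * (8 / c\<^sup>2 * exp (c * \<bar>X \<omega>\<bar>)))"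
      by (intro order_trans[OF integral_abs_bound integral_mono])
        (auto intro!: integrable_abs inth intX int)
    then show ?thesis
      by (simp add: C_def inth intX prob_space)
  qed
  have "((\<lambda>\<theta>. expectation (\<lambda>\<omega>. exp (\<theta> * X \<omega>))) has_real_derivative expectation X) (at 0)"
    unfolding DERIV_def
  proof (rule Lim_null_comparison[THEN LIM_zero_cancel])
    show "\<forall>\<^sub>F h in at 0. norm ((expectation (\<lambda>\<omega>. exp ((0 + h) * X \<omega>)) - expectation (\<lambda>\<omega>. exp (0 * X \<omega>))) / h
        - expectation X) \<le> \<bar>h\<bar> * C"
    proof -
      have "\<forall>\<^sub>F h in at (0::real). \<bar>h\<bar> < c / 2 \<and> h \<noteq> 0"
        using c by (auto simp: eventually_at dist_real_def intro!: exI[of _ "c / 2"])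
      then show ?thesis
      proof eventually_elim
        case (elim h)
        have "\<bar>(expectation (\<lambda>\<omega>. exp (h * X \<omega>)) - 1) / h - expectation X\<bar>
          = \<bar>expectation (\<lambda>\<omega>. exp (h * X \<omega>)) - 1 - h * expectation X\<bar> / \<bar>h\<bar>"
          using elim by (simp add: field_simps flip: abs_divide)
        also have "\<dots> \<le> h\<^sup>2 * C / \<bar>h\<bar>"
          using elim by (intro divide_right_mono bound) auto
        also have "\<dots> = \<bar>h\<bar> * C"
          using elim by (simp add: power2_eq_square abs_if)
        finally show ?case by (simp add: prob_space)
      qed
    qed
    show "((\<lambda>h. \<bar>h\<bar> * C) \<longlongrightarrow> 0) (at 0)"
      by (auto intro!: tendsto_eq_intros)
  qed
  from DERIV_ln_divide[THEN DERIV_chain2, OF _ this]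
  show ?thesis
    unfolding log_mgf_def by (simp add: prob_space)
qed

text \<open>
  By independence the expectation of \<open>exp (\<theta> * (X - Y))\<close> is a product in \<open>[0, \<infinity>]\<close>. Neither factor
  is \<open>0\<close>, so if the product is finite, then so are both factors.
\<close>

lemma (in prob_space) integrable_exp_of_indep_diff:
  fixes X Y :: "'a \<Rightarrow> real"
  assumes indep: "indep_var borel X borel Y"
    and int: "integrable M (\<lambda>\<omega>. exp (\<theta> * (X \<omega> - Y \<omega>)))"
  shows "integrable M (\<lambda>\<omega>. exp (\<theta> * X \<omega>))" and "integrable M (\<lambda>\<omega>. exp (- \<theta> * Y \<omega>))"
proof -
  let ?U = "\<lambda>\<omega>. ennreal (exp (\<theta> * X \<omega>))" and ?V = "\<lambda>\<omega>. ennreal (exp (- \<theta> * Y \<omega>))"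
  have [measurable]: "random_variable borel X" "random_variable borel Y"
    using indep by (auto dest: indep_var_rv1 indep_var_rv2)
  have "indep_var borel ((\<lambda>x. ennreal (exp (\<theta> * x))) \<circ> X) borel ((\<lambda>x. ennreal (exp (- \<theta> * x))) \<circ> Y)"
    using indep by (rule indep_var_compose) measurable
  then have "indep_vars (case_bool borel borel) (case_bool ?U ?V) UNIV"
    unfolding indep_var_def comp_def .
  also have "case_bool borel borel = (\<lambda>_. borel :: ennreal measure)"
    by (auto split: bool.split)
  finally have "indep_vars (\<lambda>_. borel) (case_bool ?U ?V) UNIV" .
  then have "(\<integral>\<^sup>+\<omega>. (\<Prod>b\<in>UNIV. case_bool ?U ?V b \<omega>) \<partial>M) = (\<Prod>b\<in>UNIV. \<integral>\<^sup>+\<omega>. case_bool ?U ?V b \<omega> \<partial>M)"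
    by (rule indep_vars_nn_integral[rotated]) auto
  then have "(\<integral>\<^sup>+\<omega>. ?U \<omega> \<partial>M) * (\<integral>\<^sup>+\<omega>. ?V \<omega> \<partial>M) = (\<integral>\<^sup>+\<omega>. ?U \<omega> * ?V \<omega> \<partial>M)"
    by (simp add: UNIV_bool mult.commute)
  also have "\<dots> = (\<integral>\<^sup>+\<omega>. ennreal (exp (\<theta> * (X \<omega> - Y \<omega>))) \<partial>M)"
    by (simp add: right_diff_distrib flip: ennreal_mult exp_add)
  also have "\<dots> < \<infinity>"
    using int by (simp add: integrable_iff_bounded)
  finally have fin: "(\<integral>\<^sup>+\<omega>. ?U \<omega> \<partial>M) * (\<integral>\<^sup>+\<omega>. ?V \<omega> \<partial>M) < \<infinity>" .
  have "(\<integral>\<^sup>+\<omega>. ennreal (exp (Z \<omega>)) \<partial>M) \<noteq> 0" if [measurable]: "random_variable borel Z" for Z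
    using prob_space not_AE_zero_ennreal_E by (subst nn_integral_0_iff_AE) auto
  then have "(\<integral>\<^sup>+\<omega>. ?U \<omega> \<partial>M) \<noteq> 0" "(\<integral>\<^sup>+\<omega>. ?V \<omega> \<partial>M) \<noteq> 0" by auto
  with fin have "(\<integral>\<^sup>+\<omega>. ?U \<omega> \<partial>M) < \<infinity>" "(\<integral>\<^sup>+\<omega>. ?V \<omega> \<partial>M) < \<infinity>"
    by (auto simp: ennreal_mult_less_top)
  then show "integrable M (\<lambda>\<omega>. exp (\<theta> * X \<omega>))" "integrable M (\<lambda>\<omega>. exp (- \<theta> * Y \<omega>))"
    by (auto simp: integrable_iff_bounded)
qed

lemma sample_path_eval:
  "0 \<le> t \<Longrightarrow> (\<lambda>f. f t) \<in> borel_measurable path_space" "0 \<le> t \<Longrightarrow> sample_path X \<omega> t = X t \<omega>"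
  by (auto simp: sample_path_def)

lemma (in prob_space) indep_var_sample_path_eval:
  assumes "indep_var path_space (sample_path X) path_space (sample_path Y)" "0 \<le> s" "0 \<le> t"
  shows "indep_var borel (X s) borel (Y t)"
  using indep_var_compose[OF assms(1) sample_path_eval(1)[OF assms(2)] sample_path_eval(1)[OF assms(3)]] assms(2,3)
  by (simp add: comp_def sample_path_eval(2))

lemma distr_sample_path_eval:
  assumes "sample_path X \<in> measurable M path_space" "0 \<le> t"
  shows "distr M borel (X t) = distr (distr M path_space (sample_path X)) borel (\<lambda>f. f t)"
  using assms by (simp add: distr_distr sample_path_eval comp_def)

text \<open>
  The factorisation at \<open>\<theta> = c\<close> bounds the upper tail of \<open>S1 1\<close>, and at \<open>\<theta> = - c\<close> that of \<open>S2 1\<close>.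
  The lower tails vanish because subordinators are nonnegative.
\<close>

lemma exp_moments_of_difference:
  assumes "levy_process N S" and "log_mgf_finite_near_0 N (S 1)"
    and S1: "subordinator M S1" and S2: "subordinator M S2"
    and indep: "prob_space.indep_var M path_space (sample_path S1) path_space (sample_path S2)"
    and distr_eq: "distr N path_space (sample_path S) =
         distr M path_space (sample_path (\<lambda>t \<omega>. S1 t \<omega> - S2 t \<omega>))"
  obtains c where "0 < c" "integrable M (\<lambda>\<omega>. exp (c * \<bar>S1 1 \<omega>\<bar>))" "integrable M (\<lambda>\<omega>. exp (c * \<bar>S2 1 \<omega>\<bar>))"
proof -
  interpret N: levy_process N S by fact
  interpret S1: subordinator M S1 by fact
  interpret S2: subordinator M S2 by fact
  have [measurable]: "S 1 \<in> borel_measurable N" "S1 1 \<in> borel_measurable M" "S2 1 \<in> borel_measurable M"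
    by (auto intro: N.measurable_X S1.measurable_X S2.measurable_X)
  have "distr N borel (S 1) = distr M borel (\<lambda>\<omega>. S1 1 \<omega> - S2 1 \<omega>)"
  proof -
    have "sample_path S \<in> measurable N path_space"
      unfolding sample_path_def by (intro measurable_restrict N.measurable_X) auto
    moreover have "sample_path (\<lambda>t \<omega>. S1 t \<omega> - S2 t \<omega>) \<in> measurable M path_space"
      unfolding sample_path_def
      by (intro measurable_restrict borel_measurable_diff S1.measurable_X S2.measurable_X) auto
    ultimately show ?thesis
      using distr_sample_path_eval[of S N 1] distr_sample_path_eval[of "\<lambda>t \<omega>. S1 t \<omega> - S2 t \<omega>" M 1]
      by (simp add: distr_eq)
  qed
  then have int: "integrable N (\<lambda>\<omega>. exp (\<theta> * S 1 \<omega>)) \<longleftrightarrow> integrable M (\<lambda>\<omega>. exp (\<theta> * (S1 1 \<omega> - S2 1 \<omega>)))" for \<theta>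
    using integrable_distr_eq[of "S 1" N borel "\<lambda>x. exp (\<theta> * x)"]
      integrable_distr_eq[of "\<lambda>\<omega>. S1 1 \<omega> - S2 1 \<omega>" M borel "\<lambda>x. exp (\<theta> * x)"]
    by simp
  obtain e where e: "0 < e" "\<And>\<theta>. \<bar>\<theta>\<bar> < e \<Longrightarrow> integrable N (\<lambda>\<omega>. exp (\<theta> * S 1 \<omega>))"
    using assms(2) by (auto simp: log_mgf_finite_near_0_def eventually_nhds_metric dist_real_def)
  define c where "c = e / 2"
  have c: "0 < c" "c < e" using e by (auto simp: c_def)
  have ind: "S1.indep_var borel (S1 1) borel (S2 1)"
    by (rule S1.indep_var_sample_path_eval[OF indep]) auto
  have pos: "integrable M (\<lambda>\<omega>. exp (c * S1 1 \<omega>))"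
    using e(2)[of c] c by (intro S1.integrable_exp_of_indep_diff(1)[OF ind]) (simp add: int)
  have neg: "integrable M (\<lambda>\<omega>. exp (c * S2 1 \<omega>))"
    using S1.integrable_exp_of_indep_diff(2)[OF ind, of "- c"] e(2)[of "- c"] c unfolding int by simp
  show thesis
  proof (rule that[OF c(1)])
    show "integrable M (\<lambda>\<omega>. exp (c * \<bar>S1 1 \<omega>\<bar>))"
    proof (rule integrable_cong_AE_imp[OF pos])
      show "AE \<omega> in M. exp (c * S1 1 \<omega>) = exp (c * \<bar>S1 1 \<omega>\<bar>)"
        using S1.nonneg_AE[of 1, OF zero_le_one] by eventually_elim simp
    qed measurable
    show "integrable M (\<lambda>\<omega>. exp (c * \<bar>S2 1 \<omega>\<bar>))"
    proof (rule integrable_cong_AE_imp[OF neg])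
      show "AE \<omega> in M. exp (c * S2 1 \<omega>) = exp (c * \<bar>S2 1 \<omega>\<bar>)"
        using S2.nonneg_AE[of 1, OF zero_le_one] by eventually_elim simp
    qed measurable
  qed
qed

section \<open>Weak law of large numbers for subordinators\<close>

lemma (in levy_process) distr_increment:
  assumes "0 \<le> s" and "s \<le> t"
  shows "distr M borel (\<lambda>\<omega>. X t \<omega> - X s \<omega>) = distr M borel (X (t - s))"
  using stationary_increments[of s "t - s"] assms by simp

lemma (in levy_process) indep_consecutive_increments:
  assumes "0 \<le> s" "s \<le> t" "t \<le> u"
  shows "indep_var borel (\<lambda>\<omega>. X t \<omega> - X s \<omega>) borel (\<lambda>\<omega>. X u \<omega> - X t \<omega>)"
proof -
  define p :: "nat \<Rightarrow> real" where "p i = (if i = 0 then s else if i = 1 then t else u)" for i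
  have "indep_vars (\<lambda>_. borel) (\<lambda>i \<omega>. X (p (Suc i)) \<omega> - X (p i) \<omega>) {..<2}"
    using assms by (intro independent_increments) (auto simp: p_def mono_on_def)
  then have "indep_vars (\<lambda>_. borel) (\<lambda>i \<omega>. X (p (Suc i)) \<omega> - X (p i) \<omega>) (insert 0 {1})"
    by (simp add: lessThan_Suc numeral_2_eq_2 insert_commute)
  then have "indep_var borel (\<lambda>\<omega>. X (p (Suc 0)) \<omega> - X (p 0) \<omega>) borel (\<lambda>\<omega>. \<Sum>i\<in>{1}. X (p (Suc i)) \<omega> - X (p i) \<omega>)"
    by (intro indep_vars_sum) auto
  then show ?thesis by (simp add: p_def)
qed

text \<open>
  The increments over unit intervals are independent copies of \<open>X 1\<close>, so their variances add up.
  The value \<open>X 0\<close> is subtracted because independence is available for increments only.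
\<close>

lemma (in levy_process) expectation_centered_square:
  assumes sq: "integrable M (\<lambda>\<omega>. (X 1 \<omega>)\<^sup>2)"
  defines "Y n \<omega> \<equiv> X (real n) \<omega> - X 0 \<omega> - real n * expectation (X 1)"
  shows "integrable M (\<lambda>\<omega>. (Y n \<omega>)\<^sup>2) \<and> expectation (\<lambda>\<omega>. (Y n \<omega>)\<^sup>2) = real n * variance (X 1)"
proof (induction n)
  case 0
  show ?case by (simp add: Y_def)
next
  case (Suc n)
  let ?m = "expectation (X 1)"
  define Z where "Z \<omega> = X (real (Suc n)) \<omega> - X (real n) \<omega> - ?m" for \<omega>
  have [measurable]: "X (real k) \<in> borel_measurable M" "X 0 \<in> borel_measurable M" "X 1 \<in> borel_measurable M" for k
    by (auto intro: measurable_X)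
  have [measurable]: "Y n \<in> borel_measurable M" "Z \<in> borel_measurable M"
    unfolding Y_def Z_def by measurable
  have int1: "integrable M (X 1)"
    using sq by (rule square_integrable_imp_integrable[rotated]) simp
  have sqc: "integrable M (\<lambda>\<omega>. (X 1 \<omega> - ?m)\<^sup>2)"
    using sq int1 by (simp add: power2_diff)
  have [measurable]: "(\<lambda>\<omega>. X (1 + real n) \<omega>) \<in> borel_measurable M"
    by (auto intro: measurable_X)
  have law: "distr M borel (\<lambda>\<omega>. X (real (Suc n)) \<omega> - X (real n) \<omega>) = distr M borel (X 1)"
    by (subst distr_increment) auto
  have Z_eq: "integrable M (\<lambda>\<omega>. f (Z \<omega>)) \<longleftrightarrow> integrable M (\<lambda>\<omega>. f (X 1 \<omega> - ?m))"
    "expectation (\<lambda>\<omega>. f (Z \<omega>)) = expectation (\<lambda>\<omega>. f (X 1 \<omega> - ?m))"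
    if [measurable]: "f \<in> borel_measurable borel" for f :: "real \<Rightarrow> real"
  proof -
    have "integrable M (\<lambda>\<omega>. f (Z \<omega>))
      \<longleftrightarrow> integrable (distr M borel (\<lambda>\<omega>. X (real (Suc n)) \<omega> - X (real n) \<omega>)) (\<lambda>x. f (x - ?m))"
      by (subst integrable_distr_eq) (auto simp: Z_def)
    also have "\<dots> \<longleftrightarrow> integrable M (\<lambda>\<omega>. f (X 1 \<omega> - ?m))"
      unfolding law by (subst integrable_distr_eq) auto
    finally show "integrable M (\<lambda>\<omega>. f (Z \<omega>)) \<longleftrightarrow> integrable M (\<lambda>\<omega>. f (X 1 \<omega> - ?m))" .
    have "expectation (\<lambda>\<omega>. f (Z \<omega>))
      = integral\<^sup>L (distr M borel (\<lambda>\<omega>. X (real (Suc n)) \<omega> - X (real n) \<omega>)) (\<lambda>x. f (x - ?m))"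
      by (subst integral_distr) (auto simp: Z_def)
    also have "\<dots> = expectation (\<lambda>\<omega>. f (X 1 \<omega> - ?m))"
      unfolding law by (subst integral_distr) auto
    finally show "expectation (\<lambda>\<omega>. f (Z \<omega>)) = expectation (\<lambda>\<omega>. f (X 1 \<omega> - ?m))" .
  qed
  have Zsq: "integrable M (\<lambda>\<omega>. (Z \<omega>)\<^sup>2)" "expectation (\<lambda>\<omega>. (Z \<omega>)\<^sup>2) = variance (X 1)"
    using Z_eq[of "\<lambda>x. x\<^sup>2"] sqc by auto
  have Z: "integrable M Z" "expectation Z = 0"
    using Z_eq[of "\<lambda>x. x"] int1 by (auto simp: prob_space)
  have Y: "integrable M (Y n)"
    using Suc.IH by (intro square_integrable_imp_integrable[of "Y n"]) simp_all
  have "indep_var borel ((\<lambda>x. x - real n * ?m) \<circ> (\<lambda>\<omega>. X (real n) \<omega> - X 0 \<omega>))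
     borel ((\<lambda>x. x - ?m) \<circ> (\<lambda>\<omega>. X (real (Suc n)) \<omega> - X (real n) \<omega>))"
  proof (rule indep_var_compose)
    show "indep_var borel (\<lambda>\<omega>. X (real n) \<omega> - X 0 \<omega>) borel (\<lambda>\<omega>. X (real (Suc n)) \<omega> - X (real n) \<omega>)"
      by (rule indep_consecutive_increments) simp_all
  qed measurable
  then have "indep_var borel (Y n) borel Z"
    by (simp add: comp_def Y_def[abs_def] Z_def[abs_def])
  with Y Z have YZ: "integrable M (\<lambda>\<omega>. Y n \<omega> * Z \<omega>)" "expectation (\<lambda>\<omega>. Y n \<omega> * Z \<omega>) = 0"
    by (auto simp: indep_var_integrable indep_var_lebesgue_integral)
  have split: "(Y (Suc n) \<omega>)\<^sup>2 = (Y n \<omega>)\<^sup>2 + 2 * (Y n \<omega> * Z \<omega>) + (Z \<omega>)\<^sup>2" for \<omega>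
    by (simp add: Y_def Z_def power2_eq_square algebra_simps)
  show ?case
    using Suc.IH YZ Zsq unfolding split by (simp add: distrib_right)
qed

lemma (in levy_process) prob_deviation_le:
  assumes sq: "integrable M (\<lambda>\<omega>. (X 1 \<omega>)\<^sup>2)" and "0 < a"
  shows "prob {\<omega> \<in> space M. a \<le> \<bar>X (real n) \<omega> - real n * expectation (X 1)\<bar>} \<le> real n * variance (X 1) / a\<^sup>2"
proof -
  let ?m = "expectation (X 1)"
  have [measurable]: "X (real n) \<in> borel_measurable M" "X 0 \<in> borel_measurable M"
    by (auto intro: measurable_X)
  note * = expectation_centered_square[OF sq, of n]
  have "prob {\<omega> \<in> space M. a \<le> \<bar>X (real n) \<omega> - real n * ?m\<bar>}
     = prob {\<omega> \<in> space M. a\<^sup>2 \<le> (X (real n) \<omega> - X 0 \<omega> - real n * ?m)\<^sup>2}"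
  proof (rule prob_eq_AE)
    show "AE \<omega> in M. a \<le> \<bar>X (real n) \<omega> - real n * ?m\<bar> \<longleftrightarrow> a\<^sup>2 \<le> (X (real n) \<omega> - X 0 \<omega> - real n * ?m)\<^sup>2"
      using X_zero by eventually_elim (use \<open>0 < a\<close> in \<open>simp flip: abs_le_square_iff\<close>)
  qed measurable
  also have "\<dots> \<le> expectation (\<lambda>\<omega>. (X (real n) \<omega> - X 0 \<omega> - real n * ?m)\<^sup>2) / a\<^sup>2"
    using * \<open>0 < a\<close> by (intro integral_Markov_inequality_measure[where A = "{}"]) auto
  finally show ?thesis using * by simp
qed

text \<open>
  The interval \<open>[0, K * s]\<close> is covered by \<open>J\<close> cells of integer length \<open>n\<close>, where \<open>J\<close> is fixed and
  \<open>n\<close> is about \<open>K * s / J\<close>. Each of the finitely many grid points deviates by \<open>\<epsilon> * s / 2\<close> with a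
  probability of order \<open>1 / s\<close>. Between grid points a monotone path and the line of slope \<open>m\<close> are both
  squeezed, at an additional cost of one mesh \<open>m * n\<close>, which is at most \<open>\<epsilon> * s / 2\<close> once \<open>J\<close> is
  large compared with \<open>m * K / \<epsilon>\<close>.
\<close>

lemma (in subordinator) uniform_weak_law:
  assumes sq: "integrable M (\<lambda>\<omega>. (X 1 \<omega>)\<^sup>2)"
    and "0 < K" "0 < \<epsilon>" "0 < \<eta>"
  shows "\<forall>\<^sub>F s in at_top. \<exists>A\<in>sets M. prob A \<le> \<eta> \<and>
    (AE \<omega> in M. \<omega> \<notin> A \<longrightarrow> (\<forall>u\<in>{0..K * s}. \<bar>X u \<omega> - expectation (X 1) * u\<bar> \<le> \<epsilon> * s))"
proof -
  define m where "m = expectation (X 1)"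
  define v where "v = variance (X 1)"
  have m: "0 \<le> m"
    unfolding m_def using nonneg_AE[of 1] by (intro integral_nonneg_AE) auto
  have v: "0 \<le> v" unfolding v_def by (intro integral_nonneg_AE) auto
  \<comment> \<open>The factor \<open>4\<close> leaves \<open>\<epsilon> * s / 4\<close> for rounding \<open>n\<close> up to an integer.\<close>
  define J where "J = nat \<lceil>4 * m * K / \<epsilon>\<rceil> + 1"
  have J: "4 * m * K \<le> real J * \<epsilon>" "1 \<le> J"
  proof -
    have "4 * m * K / \<epsilon> \<le> real J" unfolding J_def by linarith
    then show "4 * m * K \<le> real J * \<epsilon>" using \<open>0 < \<epsilon>\<close> by (simp add: field_simps)
  qed (simp add: J_def)
  define bound where "bound s = (real J + 2) * ((real J + 1) * (K * s / real J + 1) * v / (\<epsilon> * s / 2)\<^sup>2)" for s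
  have "(bound \<longlongrightarrow> 0) at_top"
    unfolding bound_def using \<open>0 < \<epsilon>\<close> J by real_asymp
  then have "\<forall>\<^sub>F s in at_top. bound s < \<eta>"
    using \<open>0 < \<eta>\<close> by (intro order_tendstoD) auto
  then show ?thesis
    using eventually_ge_at_top[of "4 * m / \<epsilon>"] eventually_gt_at_top[of 0]
  proof eventually_elim
    case (elim s)
    define n where "n = nat \<lceil>K * s / real J\<rceil>"
    have Ks: "0 < K * s / real J" using elim \<open>0 < K\<close> J by simp
    then have n: "K * s / real J \<le> real n" "real n \<le> K * s / real J + 1" "0 < n"
      unfolding n_def by (linarith, linarith, simp)
    have mesh: "m * real n \<le> \<epsilon> * s / 2"
    proof -
      have "m * (K * s / real J) \<le> \<epsilon> * s / 4"
        using J mult_right_mono[OF J(1), of s] elim by (simp add: field_simps)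
      moreover have "m \<le> \<epsilon> * s / 4"
        using elim \<open>0 < \<epsilon>\<close> by (simp add: field_simps)
      moreover have "m * real n \<le> m * (K * s / real J) + m"
        using mult_left_mono[OF n(2) m] by (simp add: algebra_simps)
      ultimately show ?thesis by linarith
    qed
    define D where "D k = {\<omega> \<in> space M. \<epsilon> * s / 2 \<le> \<bar>X (real k) \<omega> - real k * m\<bar>}" for k
    have D[measurable]: "D k \<in> sets M" for k
    proof -
      have [measurable]: "X (real k) \<in> borel_measurable M" by (auto intro: measurable_X)
      show ?thesis unfolding D_def by measurable
    qed
    \<comment> \<open>The index \<open>J + 1\<close> provides a right neighbour when \<open>u\<close> is the last grid point \<open>J * n\<close>.\<close>
    define A where "A = (\<Union>j\<le>J + 1. D (j * n))"
    have "prob A \<le> (\<Sum>j\<le>J + 1. prob (D (j * n)))"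
      unfolding A_def by (intro finite_measure_subadditive_finite) auto
    also have "\<dots> \<le> (\<Sum>j\<le>J + 1. (real J + 1) * (K * s / real J + 1) * v / (\<epsilon> * s / 2)\<^sup>2)"
    proof (rule sum_mono)
      fix j assume "j \<in> {..J + 1}"
      have "prob (D (j * n)) \<le> real (j * n) * v / (\<epsilon> * s / 2)\<^sup>2"
        unfolding D_def m_def v_def using elim \<open>0 < \<epsilon>\<close> by (intro prob_deviation_le sq) auto
      also have "\<dots> \<le> (real J + 1) * (K * s / real J + 1) * v / (\<epsilon> * s / 2)\<^sup>2"
        unfolding of_nat_mult using \<open>j \<in> {..J + 1}\<close> n v by (intro divide_right_mono mult_right_mono mult_mono) auto
      finally show "prob (D (j * n)) \<le> (real J + 1) * (K * s / real J + 1) * v / (\<epsilon> * s / 2)\<^sup>2" .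
    qed
    also have "\<dots> = bound s" by (simp add: bound_def)
    finally have "prob A \<le> \<eta>" using elim by simp
    moreover have "A \<in> sets M" unfolding A_def by measurable
    moreover have "AE \<omega> in M. \<omega> \<notin> A \<longrightarrow> (\<forall>u\<in>{0..K * s}. \<bar>X u \<omega> - m * u\<bar> \<le> \<epsilon> * s)"
      using nondecreasing_paths AE_space
    proof eventually_elim
      case (elim \<omega>)
      show ?case
      proof (intro impI ballI)
        fix u assume "\<omega> \<notin> A" and u: "u \<in> {0..K * s}"
        define j where "j = nat \<lfloor>u / real n\<rfloor>"
        have "real j \<le> u / real n" "u / real n < real j + 1"
          using u n unfolding j_def by auto
        then have j: "real j * real n \<le> u" "u \<le> (real j + 1) * real n"
          using n by (auto simp: field_simps)
        have "u \<le> real J * real n"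
          using u n(1) J(2) by (simp add: field_simps)
        with j n have "real j \<le> real J"
          using order_trans[OF j(1)] by (meson mult_le_cancel_right_pos of_nat_0_less_iff)
        then have "j \<le> J" by simp
        then have "j \<in> {..J + 1}" "j + 1 \<in> {..J + 1}" by auto
        with \<open>\<omega> \<notin> A\<close> have "\<omega> \<notin> D (j * n)" "\<omega> \<notin> D ((j + 1) * n)"
          unfolding A_def by blast+
        then have dev: "\<bar>X (real j * real n) \<omega> - m * (real j * real n)\<bar> < \<epsilon> * s / 2"
          "\<bar>X ((real j + 1) * real n) \<omega> - m * ((real j + 1) * real n)\<bar> < \<epsilon> * s / 2"
          using elim(2) by (auto simp: D_def algebra_simps)
        have "X (real j * real n) \<omega> \<le> X u \<omega>" "X u \<omega> \<le> X ((real j + 1) * real n) \<omega>"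
          using elim(1) u j by (auto simp: mono_on_def)
        moreover have "m * (real j * real n) \<le> m * u" "m * u \<le> m * ((real j + 1) * real n)"
          using j m by (auto intro!: mult_left_mono)
        moreover have "m * ((real j + 1) * real n) = m * (real j * real n) + m * real n"
          by (simp add: algebra_simps)
        ultimately show "\<bar>X u \<omega> - m * u\<bar> \<le> \<epsilon> * s"
          using dev mesh unfolding abs_le_iff abs_less_iff by linarith
      qed
    qed
    ultimately show ?case unfolding m_def by blast
  qed
qed

lemma (in prob_space) tight_of_eq_distr:
  assumes "real_distribution \<mu>" and "0 < \<eta>"
  obtains K where "0 < K" "\<And>Z. Z \<in> borel_measurable M \<Longrightarrow> distr M borel Z = \<mu> \<Longrightarrow> prob {\<omega> \<in> space M. K < Z \<omega>} \<le> \<eta>"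
proof -
  interpret \<mu>: real_distribution \<mu> by fact
  have "\<forall>\<^sub>F K in at_top. 1 - \<eta> < cdf \<mu> K"
    using \<mu>.cdf_lim_at_top_prob \<open>0 < \<eta>\<close> by (intro order_tendstoD) auto
  then have "\<forall>\<^sub>F K in at_top. 1 - \<eta> < cdf \<mu> K \<and> 0 < K"
    using eventually_gt_at_top[of 0] by eventually_elim auto
  then obtain K where K: "1 - \<eta> < cdf \<mu> K" "0 < K"
    using eventually_happens'[OF trivial_limit_at_top_linorder] by blast
  show thesis
  proof (rule that[OF K(2)])
    fix Z assume [measurable]: "Z \<in> borel_measurable M" and Z: "distr M borel Z = \<mu>"
    have "cdf \<mu> K = prob {\<omega> \<in> space M. Z \<omega> \<le> K}"
      unfolding Z[symmetric] by (rule cdf_distr_eq_prob) measurable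
    also have "{\<omega> \<in> space M. Z \<omega> \<le> K} = space M - {\<omega> \<in> space M. K < Z \<omega>}" by auto
    finally show "prob {\<omega> \<in> space M. K < Z \<omega>} \<le> \<eta>"
      using K by (subst (asm) prob_compl) auto
  qed
qed

lemma (in subordinator) weak_law_at_random_times:
  fixes T :: "real \<Rightarrow> 'a \<Rightarrow> real"
  assumes sq: "integrable M (\<lambda>\<omega>. (X 1 \<omega>)\<^sup>2)"
    and r: "filterlim r at_top at_top"
    and [measurable]: "\<And>t. 0 < t \<Longrightarrow> T t \<in> borel_measurable M"
    and nonneg: "\<And>t. 0 < t \<Longrightarrow> AE \<omega> in M. 0 \<le> T t \<omega>"
    and distr: "\<And>t. 0 < t \<Longrightarrow> distr M borel (\<lambda>\<omega>. T t \<omega> / r t) = \<mu>" and \<mu>: "real_distribution \<mu>"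
    and "0 < \<epsilon>" "0 < \<eta>"
  shows "\<forall>\<^sub>F t in at_top. \<exists>A\<in>sets M. prob A \<le> \<eta> \<and>
    (AE \<omega> in M. \<omega> \<notin> A \<longrightarrow> \<bar>X (T t \<omega>) \<omega> - expectation (X 1) * T t \<omega>\<bar> \<le> \<epsilon> * r t)"
proof -
  obtain K where K: "0 < K"
    "\<And>Z. Z \<in> borel_measurable M \<Longrightarrow> distr M borel Z = \<mu> \<Longrightarrow> prob {\<omega> \<in> space M. K < Z \<omega>} \<le> \<eta> / 2"
    using tight_of_eq_distr[OF \<mu>, of "\<eta> / 2"] \<open>0 < \<eta>\<close> by auto
  have "\<forall>\<^sub>F t in at_top. \<exists>A\<in>sets M. prob A \<le> \<eta> / 2 \<and>
    (AE \<omega> in M. \<omega> \<notin> A \<longrightarrow> (\<forall>u\<in>{0..K * r t}. \<bar>X u \<omega> - expectation (X 1) * u\<bar> \<le> \<epsilon> * r t))"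
    using uniform_weak_law[OF sq K(1) \<open>0 < \<epsilon>\<close>, of "\<eta> / 2"] \<open>0 < \<eta>\<close> r by (auto simp: filterlim_iff)
  moreover have "\<forall>\<^sub>F t in at_top. 0 < r t"
    using r by (auto simp: filterlim_at_top_dense)
  ultimately show ?thesis
    using eventually_gt_at_top[of 0]
  proof eventually_elim
    case (elim t)
    then obtain A where A[measurable]: "A \<in> sets M" and "prob A \<le> \<eta> / 2"
      and AE: "AE \<omega> in M. \<omega> \<notin> A \<longrightarrow> (\<forall>u\<in>{0..K * r t}. \<bar>X u \<omega> - expectation (X 1) * u\<bar> \<le> \<epsilon> * r t)"
      by blast
    have [measurable]: "T t \<in> borel_measurable M" using elim by simp
    define B where "B = {\<omega> \<in> space M. K < T t \<omega> / r t}"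
    have B[measurable]: "B \<in> sets M" unfolding B_def by measurable
    have "prob B \<le> \<eta> / 2" unfolding B_def using elim by (intro K(2) distr) auto
    with \<open>prob A \<le> \<eta> / 2\<close> have "prob (A \<union> B) \<le> \<eta>"
      using measure_Un_le[OF A B] by linarith
    moreover have "AE \<omega> in M. \<omega> \<notin> A \<union> B \<longrightarrow> \<bar>X (T t \<omega>) \<omega> - expectation (X 1) * T t \<omega>\<bar> \<le> \<epsilon> * r t"
      using AE nonneg[OF \<open>0 < t\<close>] AE_space
    proof eventually_elim
      case (elim \<omega>)
      show ?case
      proof
        assume "\<omega> \<notin> A \<union> B"
        then have "T t \<omega> \<le> K * r t"
          using elim(3) \<open>0 < r t\<close> by (auto simp: B_def field_simps not_less)
        with elim \<open>\<omega> \<notin> A \<union> B\<close> show "\<bar>X (T t \<omega>) \<omega> - expectation (X 1) * T t \<omega>\<bar> \<le> \<epsilon> * r t"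
          by auto
      qed
    qed
    ultimately show ?case using A B by blast
  qed
qed

section \<open>Measurability at random times\<close>

text \<open>
  Approximating \<open>T\<close> from the right by dyadic random times turns \<open>X T\<close> into a limit of measurable
  variables wherever the path is right-continuous. On the exceptional null set the limit need not
  exist, but the \<open>lim\<close> operator is still a measurable function of the sequence.
\<close>

lemma (in levy_process) random_time_value_measurable_version:
  assumes [measurable]: "T \<in> borel_measurable M" and nonneg: "AE \<omega> in M. 0 \<le> T \<omega>"
  obtains Y where "Y \<in> borel_measurable M" and "AE \<omega> in M. X (T \<omega>) \<omega> = Y \<omega>"
proof -
  \<comment> \<open>The successor makes the approximation strictly larger than \<open>T\<close>, as a limit from the right requires.\<close>
  define d where "d n \<omega> = Suc (nat \<lfloor>2 ^ n * T \<omega>\<rfloor>)" for n :: nat and \<omega>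
  have [measurable]: "(\<lambda>\<omega>. X (real k / 2 ^ n) \<omega>) \<in> borel_measurable M" for k n :: nat
    by (intro measurable_X) auto
  have [measurable]: "d n \<in> measurable M (count_space UNIV)" for n
    unfolding d_def by measurable
  have [measurable]: "(\<lambda>\<omega>. X (real (d n \<omega>) / 2 ^ n) \<omega>) \<in> borel_measurable M" for n
    by (rule measurable_compose_countable[where f = "\<lambda>k \<omega>. X (real k / 2 ^ n) \<omega>"]) measurable
  have "(\<lambda>\<omega>. lim (\<lambda>n. X (real (d n \<omega>) / 2 ^ n) \<omega>)) \<in> borel_measurable M"
    by measurable
  moreover have "AE \<omega> in M. X (T \<omega>) \<omega> = lim (\<lambda>n. X (real (d n \<omega>) / 2 ^ n) \<omega>)"
    using cadlag_paths nonneg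
  proof eventually_elim
    case (elim \<omega>)
    have bounds: "T \<omega> < real (d n \<omega>) / 2 ^ n" "real (d n \<omega>) / 2 ^ n \<le> T \<omega> + (1 / 2) ^ n" for n
    proof -
      have "real (d n \<omega>) = of_int \<lfloor>2 ^ n * T \<omega>\<rfloor> + 1"
        using elim(2) by (simp add: d_def)
      then have "2 ^ n * T \<omega> < real (d n \<omega>)" "real (d n \<omega>) \<le> 2 ^ n * T \<omega> + 1"
        by linarith+
      then show "T \<omega> < real (d n \<omega>) / 2 ^ n" "real (d n \<omega>) / 2 ^ n \<le> T \<omega> + (1 / 2) ^ n"
        by (auto simp: field_simps)
    qed
    have "(\<lambda>n. T \<omega> + (1 / 2) ^ n) \<longlonglongrightarrow> T \<omega> + 0"
      by (intro tendsto_add tendsto_const LIMSEQ_power_zero) auto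
    then have "(\<lambda>n. real (d n \<omega>) / 2 ^ n) \<longlonglongrightarrow> T \<omega>"
      using bounds less_imp_le[OF bounds(1)]
      by (intro tendsto_sandwich[OF _ _ tendsto_const[of "T \<omega>"] \<open>_ \<longlonglongrightarrow> T \<omega> + 0\<close>[unfolded add_0_right]]
          always_eventually allI)
    then have "filterlim (\<lambda>n. real (d n \<omega>) / 2 ^ n) (at_right (T \<omega>)) sequentially"
      using bounds by (auto simp: filterlim_at less_imp_neq[symmetric])
    moreover have "((\<lambda>t. X t \<omega>) \<longlongrightarrow> X (T \<omega>) \<omega>) (at_right (T \<omega>))"
      using elim by (simp add: cadlag_def continuous_within)
    ultimately have "(\<lambda>n. X (real (d n \<omega>) / 2 ^ n) \<omega>) \<longlonglongrightarrow> X (T \<omega>) \<omega>"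
      by (rule filterlim_compose[rotated])
    then show ?case by (simp add: limI)
  qed
  ultimately show thesis by (rule that)
qed

lemma (in prob_space) law_eq_distr:
  assumes "Y \<in> borel_measurable M" and AE: "AE \<omega> in M. X \<omega> = Y \<omega>"
  shows "law M X = distr M borel Y"
proof -
  have Y: "Y \<in> borel_measurable (completion M)"
    using assms(1) by (rule measurable_completion)
  have AEc: "AE \<omega> in completion M. X \<omega> = Y \<omega>" using AE by (rule AE_completion)
  have "X \<in> borel_measurable (completion M)"
  proof (rule measurableI)
    fix B :: "real set" assume "B \<in> sets borel"
    show "X -` B \<inter> space (completion M) \<in> sets (completion M)"
    proof (rule completion.in_sets_AE)
      show "Y -` B \<inter> space (completion M) \<in> sets (completion M)"
        using Y \<open>B \<in> sets borel\<close> by (rule measurable_sets)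
      show "AE \<omega> in completion M. \<omega> \<in> Y -` B \<inter> space (completion M) \<longleftrightarrow> \<omega> \<in> X -` B \<inter> space (completion M)"
        using AEc by eventually_elim auto
    qed auto
  qed auto
  with Y AEc have "law M X = distr (completion M) borel Y"
    unfolding law_def by (intro distr_cong_AE) auto
  with assms(1) show ?thesis by (simp add: distr_completion)
qed

section \<open>Convergence in distribution\<close>

text \<open>
  This is Slutsky's theorem in the special case that one of the two families has a constant law.
  Closeness is stated through measurable exceptional sets of small probability.
\<close>

lemma (in prob_space) weak_conv_filter_of_small_distance:
  fixes X Y :: "'i \<Rightarrow> 'a \<Rightarrow> real"
  assumes meas: "\<forall>\<^sub>F i in F. X i \<in> borel_measurable M \<and> Y i \<in> borel_measurable M \<and> distr M borel (Y i) = \<mu>"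
    and close: "\<And>\<epsilon> \<eta>. 0 < \<epsilon> \<Longrightarrow> 0 < \<eta> \<Longrightarrow> \<forall>\<^sub>F i in F. \<exists>A\<in>sets M. prob A \<le> \<eta> \<and>
      (AE \<omega> in M. \<omega> \<notin> A \<longrightarrow> \<bar>X i \<omega> - Y i \<omega>\<bar> \<le> \<epsilon>)"
  shows "weak_conv_filter (\<lambda>i. distr M borel (X i)) \<mu> F"
  unfolding weak_conv_filter_def
proof (intro allI impI tendstoI)
  fix x e :: real assume cont: "isCont (cdf \<mu>) x" and "0 < e"
  then obtain d where d: "0 < d" "\<And>y. dist y x < d \<Longrightarrow> dist (cdf \<mu> y) (cdf \<mu> x) < e / 2"
    unfolding continuous_at_eps_delta by (metis half_gt_zero)
  have le: "cdf (distr M borel U) a \<le> cdf (distr M borel V) b + \<eta>"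
    if [measurable]: "U \<in> borel_measurable M" "V \<in> borel_measurable M" "A \<in> sets M"
      and "prob A \<le> \<eta>" and ae: "AE \<omega> in M. \<omega> \<notin> A \<longrightarrow> V \<omega> \<le> U \<omega> + (b - a)" for U V a b A \<eta>
  proof -
    have "prob {\<omega> \<in> space M. U \<omega> \<le> a} \<le> prob ({\<omega> \<in> space M. V \<omega> \<le> b} \<union> A)"
    proof (rule finite_measure_mono_AE)
      show "AE \<omega> in M. \<omega> \<in> {\<omega> \<in> space M. U \<omega> \<le> a} \<longrightarrow> \<omega> \<in> {\<omega> \<in> space M. V \<omega> \<le> b} \<union> A"
        using ae by eventually_elim auto
    qed measurable
    also have "\<dots> \<le> prob {\<omega> \<in> space M. V \<omega> \<le> b} + prob A"
      by (intro measure_Un_le) auto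
    finally show ?thesis using \<open>prob A \<le> \<eta>\<close> by (simp add: cdf_distr_eq_prob)
  qed
  have "\<forall>\<^sub>F i in F. \<exists>A\<in>sets M. prob A \<le> e / 3 \<and> (AE \<omega> in M. \<omega> \<notin> A \<longrightarrow> \<bar>X i \<omega> - Y i \<omega>\<bar> \<le> d / 2)"
    using d \<open>0 < e\<close> by (intro close) auto
  with meas show "\<forall>\<^sub>F i in F. dist (cdf (distr M borel (X i)) x) (cdf \<mu> x) < e"
  proof eventually_elim
    case (elim i)
    then obtain A where A: "A \<in> sets M" "prob A \<le> e / 3"
      and ae: "AE \<omega> in M. \<omega> \<notin> A \<longrightarrow> \<bar>X i \<omega> - Y i \<omega>\<bar> \<le> d / 2" by blast
    have "cdf (distr M borel (X i)) x \<le> cdf (distr M borel (Y i)) (x + d / 2) + e / 3"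
    proof (rule le[OF _ _ A])
      show "AE \<omega> in M. \<omega> \<notin> A \<longrightarrow> Y i \<omega> \<le> X i \<omega> + (x + d / 2 - x)"
        using ae by eventually_elim (intro impI, drule (1) mp, linarith)
    qed (use elim in auto)
    moreover have "cdf (distr M borel (Y i)) (x - d / 2) \<le> cdf (distr M borel (X i)) x + e / 3"
    proof (rule le[OF _ _ A])
      show "AE \<omega> in M. \<omega> \<notin> A \<longrightarrow> X i \<omega> \<le> Y i \<omega> + (x - (x - d / 2))"
        using ae by eventually_elim (intro impI, drule (1) mp, linarith)
    qed (use elim in auto)
    moreover have "dist (cdf \<mu> (x + d / 2)) (cdf \<mu> x) < e / 2" "dist (cdf \<mu> (x - d / 2)) (cdf \<mu> x) < e / 2"
      using d by (auto simp: dist_real_def)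
    ultimately show ?case
      using elim \<open>0 < e\<close> by (simp add: dist_real_def abs_if split: if_splits)
  qed
qed

lemma (in prob_space) distr_indep_pair_cong:
  assumes "indep_var S X T Y" "indep_var S X' T Y'"
    and "distr M S X = distr M S X'" "distr M T Y = distr M T Y'"
    and f: "f \<in> measurable (S \<Otimes>\<^sub>M T) R"
  shows "distr M R (\<lambda>\<omega>. f (X \<omega>, Y \<omega>)) = distr M R (\<lambda>\<omega>. f (X' \<omega>, Y' \<omega>))"
proof -
  have eq: "distr M R (\<lambda>\<omega>. f (U \<omega>, V \<omega>)) = distr (distr M S U \<Otimes>\<^sub>M distr M T V) R f"
    if "indep_var S U T V" for U V
  proof -
    from that have [measurable]: "U \<in> measurable M S" "V \<in> measurable M T"
      by (auto dest: indep_var_rv1 indep_var_rv2)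
    show ?thesis
      using that f by (simp add: indep_var_distribution_eq distr_distr comp_def)
  qed
  show ?thesis by (simp add: assms(3,4) eq[OF assms(1)] eq[OF assms(2)])
qed

theorem proposition4p2:
  fixes M :: "'a measure" and N :: "'b measure"
    and S :: "real \<Rightarrow> 'b \<Rightarrow> real"
    and S1 S2 H1 H2 L1 L2 :: "real \<Rightarrow> 'a \<Rightarrow> real"
    and \<nu> \<alpha>1 m1 m2 :: real
  assumes "0 < \<nu>" and "\<nu> < 1"
    and "\<alpha>1 = 1 - \<nu>"
    and "levy_process N S"
    and "log_mgf_finite_near_0 N (S 1)"
    and "has_bounded_variation N S"
    and "\<not> subordinator N S"
    and "subordinator M S1" and "subordinator M S2"
    and "\<not> null_process M S1" and "\<not> null_process M S2"
    and "prob_space.indep_var M path_space (sample_path S1) path_space (sample_path S2)"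
    and "distr N path_space (sample_path S) =
         distr M path_space (sample_path (\<lambda>t \<omega>. S1 t \<omega> - S2 t \<omega>))"
    and "m1 = deriv (log_mgf M (S1 1)) 0"
    and "m2 = deriv (log_mgf M (S2 1)) 0"
    and "stable_subordinator M H1 \<nu>" and "L1 = inverse_process H1"
    and "stable_subordinator M H2 \<nu>" and "L2 = inverse_process H2"
    and "prob_space.indep_var M path_space (sample_path L1) path_space (sample_path L2)"
    and "prob_space.indep_var M
           (path_space \<Otimes>\<^sub>M path_space) (\<lambda>\<omega>. (sample_path L1 \<omega>, sample_path L2 \<omega>))
           (path_space \<Otimes>\<^sub>M path_space) (\<lambda>\<omega>. (sample_path S1 \<omega>, sample_path S2 \<omega>))"
  shows "weak_conv_filter
           (\<lambda>t. law M (\<lambda>\<omega>. t powr \<alpha>1 * ((S1 (L1 t \<omega>) \<omega> - S2 (L2 t \<omega>) \<omega>) / t)))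
           (law M (\<lambda>\<omega>. m1 * L1 1 \<omega> - m2 * L2 1 \<omega>))
           at_top"
proof -
  interpret S1: subordinator M S1 by fact
  interpret S2: subordinator M S2 by fact
  interpret H1: stable_subordinator M H1 \<nu> by fact
  interpret H2: stable_subordinator M H2 \<nu> by fact
  define r where "r t = t powr \<nu>" for t :: real
  have r: "filterlim r at_top at_top" "0 < t \<Longrightarrow> 0 < r t" for t
    unfolding r_def using \<open>0 < \<nu>\<close> by (real_asymp, simp)
  have indL: "S1.indep_var borel (L1 t) borel (L2 t)" if "0 \<le> t" for t
    using that by (intro S1.indep_var_sample_path_eval[OF assms(20)])
  have L[measurable]: "L1 t \<in> borel_measurable M" "L2 t \<in> borel_measurable M" if "0 \<le> t" for t
    using S1.indep_var_rv1[OF indL[OF that]] S1.indep_var_rv2[OF indL[OF that]] by auto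
  have L_nonneg: "AE \<omega> in M. 0 \<le> L1 t \<omega>" "AE \<omega> in M. 0 \<le> L2 t \<omega>" for t
    using H1.inverse_process_iff_AE[of t] H2.inverse_process_iff_AE[of t]
    unfolding assms(17,19) by auto
  have L_distr: "distr M borel (\<lambda>\<omega>. L1 t \<omega> / r t) = distr M borel (L1 1)"
    "distr M borel (\<lambda>\<omega>. L2 t \<omega> / r t) = distr M borel (L2 1)" if "0 < t" for t
    using H1.distr_inverse_process_self_similar[OF _ that] H2.distr_inverse_process_self_similar[OF _ that] L
    unfolding assms(17,19) r_def by auto
  have real_distr: "real_distribution (distr M borel (L1 1))" "real_distribution (distr M borel (L2 1))"
    by auto
  obtain c where c: "0 < c" "integrable M (\<lambda>\<omega>. exp (c * \<bar>S1 1 \<omega>\<bar>))" "integrable M (\<lambda>\<omega>. exp (c * \<bar>S2 1 \<omega>\<bar>))"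
    using exp_moments_of_difference[OF assms(4,5,8,9,12,13)] .
  have S_meas: "S1 1 \<in> borel_measurable M" "S2 1 \<in> borel_measurable M"
    by (auto intro: S1.measurable_X S2.measurable_X)
  have m: "m1 = S1.expectation (S1 1)" "m2 = S1.expectation (S2 1)"
    unfolding assms(14,15)
    using S1.log_mgf_has_derivative_at_0[OF S_meas(1) c(1,2)] S1.log_mgf_has_derivative_at_0[OF S_meas(2) c(1,3)]
    by (auto intro: DERIV_imp_deriv)
  have sq: "integrable M (\<lambda>\<omega>. (S1 1 \<omega>)\<^sup>2)" "integrable M (\<lambda>\<omega>. (S2 1 \<omega>)\<^sup>2)"
    using S1.square_integrable_of_exp[OF S_meas(1) c(1,2)] S1.square_integrable_of_exp[OF S_meas(2) c(1,3)] by auto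
  have "\<forall>t\<in>{0<..}. \<exists>Y. Y \<in> borel_measurable M \<and> (AE \<omega> in M. S1 (L1 t \<omega>) \<omega> = Y \<omega>)"
    using S1.random_time_value_measurable_version[OF L(1) L_nonneg(1)] by (metis greaterThan_iff less_imp_le)
  then obtain W1 where W1: "\<And>t. 0 < t \<Longrightarrow> W1 t \<in> borel_measurable M"
    "\<And>t. 0 < t \<Longrightarrow> AE \<omega> in M. S1 (L1 t \<omega>) \<omega> = W1 t \<omega>"
    unfolding bchoice_iff by auto
  have "\<forall>t\<in>{0<..}. \<exists>Y. Y \<in> borel_measurable M \<and> (AE \<omega> in M. S2 (L2 t \<omega>) \<omega> = Y \<omega>)"
    using S2.random_time_value_measurable_version[OF L(2) L_nonneg(2)] by (metis greaterThan_iff less_imp_le)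
  then obtain W2 where W2: "\<And>t. 0 < t \<Longrightarrow> W2 t \<in> borel_measurable M"
    "\<And>t. 0 < t \<Longrightarrow> AE \<omega> in M. S2 (L2 t \<omega>) \<omega> = W2 t \<omega>"
    unfolding bchoice_iff by auto
  define X where "X t \<omega> = (W1 t \<omega> - W2 t \<omega>) / r t" for t \<omega>
  define Y where "Y t \<omega> = m1 * (L1 t \<omega> / r t) - m2 * (L2 t \<omega> / r t)" for t \<omega>
  define \<mu> where "\<mu> = distr M borel (\<lambda>\<omega>. m1 * L1 1 \<omega> - m2 * L2 1 \<omega>)"
  have X_meas: "X t \<in> borel_measurable M" and Y_meas: "Y t \<in> borel_measurable M" if "0 < t" for t
  proof -
    have [measurable]: "L1 t \<in> borel_measurable M" "L2 t \<in> borel_measurable M"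
      "W1 t \<in> borel_measurable M" "W2 t \<in> borel_measurable M"
      using that L W1 W2 by auto
    show "X t \<in> borel_measurable M" "Y t \<in> borel_measurable M"
      unfolding X_def Y_def by measurable
  qed
  have Y_distr: "distr M borel (Y t) = \<mu>" if "0 < t" for t
  proof -
    have "S1.indep_var borel ((\<lambda>x. x / r t) \<circ> L1 t) borel ((\<lambda>x. x / r t) \<circ> L2 t)"
      by (rule S1.indep_var_compose[OF indL]) (use that in auto)
    then have "distr M borel (\<lambda>\<omega>. (\<lambda>(x, y). m1 * x - m2 * y) (L1 t \<omega> / r t, L2 t \<omega> / r t))
      = distr M borel (\<lambda>\<omega>. (\<lambda>(x, y). m1 * x - m2 * y) (L1 1 \<omega>, L2 1 \<omega>))"
      using that L_distr[OF that]
      by (intro S1.distr_indep_pair_cong[OF _ indL[of 1]]) (auto simp: comp_def)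
    then show ?thesis by (simp add: Y_def[abs_def] \<mu>_def)
  qed
  have "weak_conv_filter (\<lambda>t. distr M borel (X t)) \<mu> at_top"
  proof (rule S1.weak_conv_filter_of_small_distance)
    show "\<forall>\<^sub>F t in at_top. X t \<in> borel_measurable M \<and> Y t \<in> borel_measurable M \<and> distr M borel (Y t) = \<mu>"
      using eventually_gt_at_top[of 0] by eventually_elim (auto intro: X_meas Y_meas Y_distr)
  next
    fix \<epsilon> \<eta> :: real assume "0 < \<epsilon>" "0 < \<eta>"
    have "\<forall>\<^sub>F t in at_top. \<exists>A\<in>sets M. S1.prob A \<le> \<eta> / 2 \<and>
        (AE \<omega> in M. \<omega> \<notin> A \<longrightarrow> \<bar>S1 (L1 t \<omega>) \<omega> - S1.expectation (S1 1) * L1 t \<omega>\<bar> \<le> \<epsilon> / 2 * r t)"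
      using \<open>0 < \<epsilon>\<close> \<open>0 < \<eta>\<close>
      by (intro S1.weak_law_at_random_times[OF sq(1) r(1) _ _ L_distr(1) real_distr(1)]) (auto intro: L L_nonneg)
    moreover have "\<forall>\<^sub>F t in at_top. \<exists>A\<in>sets M. S1.prob A \<le> \<eta> / 2 \<and>
        (AE \<omega> in M. \<omega> \<notin> A \<longrightarrow> \<bar>S2 (L2 t \<omega>) \<omega> - S1.expectation (S2 1) * L2 t \<omega>\<bar> \<le> \<epsilon> / 2 * r t)"
      using \<open>0 < \<epsilon>\<close> \<open>0 < \<eta>\<close>
      by (intro S2.weak_law_at_random_times[OF sq(2) r(1) _ _ L_distr(2) real_distr(2)]) (auto intro: L L_nonneg)
    ultimately show "\<forall>\<^sub>F t in at_top. \<exists>A\<in>sets M. S1.prob A \<le> \<eta> \<and>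
        (AE \<omega> in M. \<omega> \<notin> A \<longrightarrow> \<bar>X t \<omega> - Y t \<omega>\<bar> \<le> \<epsilon>)"
      using eventually_gt_at_top[of 0]
    proof eventually_elim
      case (elim t)
      then obtain A B where AB: "A \<in> sets M" "B \<in> sets M" "S1.prob A \<le> \<eta> / 2" "S1.prob B \<le> \<eta> / 2"
        and A: "AE \<omega> in M. \<omega> \<notin> A \<longrightarrow> \<bar>S1 (L1 t \<omega>) \<omega> - m1 * L1 t \<omega>\<bar> \<le> \<epsilon> / 2 * r t"
        and B: "AE \<omega> in M. \<omega> \<notin> B \<longrightarrow> \<bar>S2 (L2 t \<omega>) \<omega> - m2 * L2 t \<omega>\<bar> \<le> \<epsilon> / 2 * r t"
        unfolding m by blast
      have "AE \<omega> in M. \<omega> \<notin> A \<union> B \<longrightarrow> \<bar>X t \<omega> - Y t \<omega>\<bar> \<le> \<epsilon>"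
        using A B W1(2)[OF \<open>0 < t\<close>] W2(2)[OF \<open>0 < t\<close>]
      proof eventually_elim
        case (elim \<omega>)
        have "X t \<omega> - Y t \<omega> = ((S1 (L1 t \<omega>) \<omega> - m1 * L1 t \<omega>) - (S2 (L2 t \<omega>) \<omega> - m2 * L2 t \<omega>)) / r t"
          using elim by (simp add: X_def Y_def diff_divide_distrib)
        moreover have "\<bar>(S1 (L1 t \<omega>) \<omega> - m1 * L1 t \<omega>) - (S2 (L2 t \<omega>) \<omega> - m2 * L2 t \<omega>)\<bar> \<le> \<epsilon> * r t"
          if "\<omega> \<notin> A \<union> B"
        proof -
          have "\<bar>S1 (L1 t \<omega>) \<omega> - m1 * L1 t \<omega>\<bar> \<le> \<epsilon> / 2 * r t" "\<bar>S2 (L2 t \<omega>) \<omega> - m2 * L2 t \<omega>\<bar> \<le> \<epsilon> / 2 * r t"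
            using elim that by auto
          then show ?thesis by linarith
        qed
        ultimately show ?case
          using r(2)[OF \<open>0 < t\<close>] by (simp add: pos_divide_le_eq)
      qed
      moreover have "S1.prob (A \<union> B) \<le> \<eta>"
        using measure_Un_le[OF AB(1,2)] AB(3,4) by linarith
      ultimately show ?case using AB by blast
    qed
  qed
  moreover have "\<mu> = law M (\<lambda>\<omega>. m1 * L1 1 \<omega> - m2 * L2 1 \<omega>)"
    unfolding \<mu>_def by (intro S1.law_eq_distr[symmetric]) auto
  moreover have "law M (\<lambda>\<omega>. t powr \<alpha>1 * ((S1 (L1 t \<omega>) \<omega> - S2 (L2 t \<omega>) \<omega>) / t)) = distr M borel (X t)"
    if "0 < t" for t
  proof (rule S1.law_eq_distr[OF X_meas[OF that]])
    have *: "t powr \<alpha>1 * (x / t) = x / r t" for x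
      using that by (simp add: assms(3) r_def powr_diff)
    show "AE \<omega> in M. t powr \<alpha>1 * ((S1 (L1 t \<omega>) \<omega> - S2 (L2 t \<omega>) \<omega>) / t) = X t \<omega>"
      using W1(2)[OF that] W2(2)[OF that] unfolding * by eventually_elim (simp add: X_def)
  qed
  then have ev: "\<forall>\<^sub>F t in at_top. cdf (distr M borel (X t)) x
      = cdf (law M (\<lambda>\<omega>. t powr \<alpha>1 * ((S1 (L1 t \<omega>) \<omega> - S2 (L2 t \<omega>) \<omega>) / t))) x" for x
    by (intro eventually_mono[OF eventually_gt_at_top[of 0]]) (simp only:)
  ultimately show ?thesis
    unfolding weak_conv_filter_def by (simp add: tendsto_cong[OF ev])
qed

end
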